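(* Let $a,c$ be positive integers. Then there exist constants $\kappa>0$ and $N$ (depending only on $a$ and $c$) such that for every $n\ge N$ and every coloring $f:[n]\to\{-1,1\}$, the number of triples $(x,y,z)\in[n]^3$ with $ax+ay-cz=0$ and $f(x)=f(y)=f(z)$ is at least $\kappa n^2$.
   Context: $[n]=\{1,2,\dots,n\}$; a coloring is any function $f:[n]\to\{-1,1\}$, and a solution is monochromatic if all three of its entries receive the same color. *)

theory Defs
  imports Complex_Main
begin

(* The domain [n] is encoded by a total function; its values outside {1..n} are irrelevant. *)
definition coloring :: "nat \<Rightarrow> (nat \<Rightarrow> int) \<Rightarrow> bool" where
  "coloring n f \<longleftrightarrow> f ` {1..n} \<subseteq> {-1, 1}"

(* Ordered triples. The equation is stated over int because subtraction on nat truncates. *)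
definition mono_solutions :: "nat \<Rightarrow> nat \<Rightarrow> nat \<Rightarrow> (nat \<Rightarrow> int) \<Rightarrow> (nat \<times> nat \<times> nat) set" where
  "mono_solutions a c n f =
     {(x, y, z). x \<in> {1..n} \<and> y \<in> {1..n} \<and> z \<in> {1..n} \<and>
        int a * int x + int a * int y - int c * int z = 0 \<and> f x = f y \<and> f y = f z}"

end

theory Submission
  imports Defs "HOL-Analysis.Function_Topology"
begin

text \<open>Put \<open>r = c / a\<close>, so that solutions are triples with \<open>x + y = r z\<close>. Every 2-colouring of the
  nonnegative quadrant of the rational plane has a monochromatic solution with \<open>x\<close>, \<open>y\<close> linearly
  independent. Indeed, if \<open>v\<close> and \<open>(r / 2) v\<close> always have the same colour, then a
  monochromatic three-term progression \<open>x, v, y\<close> gives the solution \<open>x + y = r (2 / r) v\<close>.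
  Otherwise some red \<open>u\<close> has \<open>(r / 2) u\<close> blue, and solutions containing one of these two
  vectors force the colouring to be periodic in direction \<open>u\<close> and \<open>w \<mapsto> r w - u\<close> to swap the
  colours; then each colour is closed under addition up to a shift, which is inconsistent with
  multiplication by \<open>r\<close> swapping the colours.

  By compactness finitely many independent solutions suffice. Reading a vector as a linear
  form in two integer parameters \<open>i, j \<le> \<epsilon> n\<close>, each of the order of \<open>n\<^sup>2\<close> parameter
  pairs yields a monochromatic solution, and independence makes this map boundedly many to one.\<close>

section \<open>Colourings of the rational quadrant without independent monochromatic
  solutions\<close>

text \<open>The hypothetical counterexample, refuted in \<open>contradiction\<close>. The unequal
  products are the nonzero determinant of \<open>x\<close> and \<open>y\<close>. As a locale it can
  be instantiated again after a change of basis.\<close>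

locale solution_free =
  fixes r :: rat and \<phi> :: "rat \<Rightarrow> rat \<Rightarrow> bool"
  assumes r_pos: "r > 0"
    and free: "\<And>x1 x2 y1 y2 z1 z2. \<lbrakk>x1 \<ge> 0; x2 \<ge> 0; y1 \<ge> 0; y2 \<ge> 0;
      x1 + y1 = r * z1; x2 + y2 = r * z2; x1 * y2 \<noteq> x2 * y1;
      \<phi> x1 x2 = \<phi> y1 y2; \<phi> y1 y2 = \<phi> z1 z2\<rbrakk> \<Longrightarrow> False"

text \<open>The arguments are coordinates with respect to a basis whose first vector is the vector \<open>u\<close>
  above; thus \<open>\<phi> \<beta> \<alpha>\<close> says that \<open>\<beta> u + \<alpha> e\<close> is red.\<close>

locale solution_free_split = solution_free +
  assumes red: "\<phi> 1 0" and blue: "\<not> \<phi> (r / 2) 0"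
begin

section \<open>Periodicity in the direction of \<open>u\<close>\<close>

text \<open>The vector \<open>s u\<close> is the difference between the blue
  \<open>(r / 2) u\<close> and the red \<open>u\<close>. Exchanging one for the other in a solution
  moves \<open>y\<close> by \<open>s u\<close> if \<open>z\<close> is fixed, and \<open>z\<close> by
  \<open>(s / r) u\<close> if \<open>y\<close> is fixed.\<close>

definition s :: rat where "s = (r - 2) / 2"

text \<open>For red \<open>v\<close>, the identity \<open>u + (r v - u) = r v\<close> would
  otherwise be a red solution. Here \<open>\<alpha> > 0\<close> gives independence from
  \<open>u\<close>, and the bound on \<open>\<beta>\<close> keeps \<open>r v - u\<close> in the
  quadrant.\<close>

lemma red_partner:
  assumes "\<alpha> > 0" "\<beta> \<ge> 1 / r" "\<phi> \<beta> \<alpha>"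
  shows "\<not> \<phi> (r * \<beta> - 1) (r * \<alpha>)"
proof
  assume "\<phi> (r * \<beta> - 1) (r * \<alpha>)"
  moreover have "r * \<beta> - 1 \<ge> 0"
    using assms(2) r_pos by (simp add: field_simps)
  ultimately show False
    using free[of 1 0 "r * \<beta> - 1" "r * \<alpha>" \<beta> \<alpha>] assms red r_pos by simp
qed

text \<open>The partner \<open>r v - u\<close> is blue, and so is \<open>(r / 2) u\<close>; their
  sum is \<open>r\<close> times the shifted vector, which therefore must be red.\<close>

lemma shift_up:
  assumes "\<alpha> > 0" "\<beta> \<ge> 1 / r" "\<phi> \<beta> \<alpha>"
  shows "\<phi> (\<beta> + s / r) \<alpha>"
proof (rule ccontr)
  assume n: "\<not> \<phi> (\<beta> + s / r) \<alpha>"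
  have "r * \<beta> - 1 \<ge> 0"
    using assms(2) r_pos by (simp add: field_simps)
  moreover have "r / 2 + (r * \<beta> - 1) = r * (\<beta> + s / r)"
    using r_pos by (simp add: s_def field_simps)
  ultimately show False
    using free[of "r / 2" 0 "r * \<beta> - 1" "r * \<alpha>" "\<beta> + s / r" \<alpha>] assms blue r_pos n
      red_partner[OF assms] by simp
qed

text \<open>With \<open>u\<close> and \<open>w\<close> red, \<open>z = (u + w) / r\<close> is blue.
  Since \<open>(r / 2) u + (w - s u) = r z\<close>, the vector \<open>w - s u\<close> cannot be blue
  as well.\<close>

lemma shift_down:
  assumes "\<alpha> > 0" "\<beta> \<ge> 0" "\<beta> \<ge> s" "\<phi> \<beta> \<alpha>"
  shows "\<phi> (\<beta> - s) \<alpha>"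
proof (rule ccontr)
  assume n: "\<not> \<phi> (\<beta> - s) \<alpha>"
  have "\<not> \<phi> ((1 + \<beta>) / r) (\<alpha> / r)"
    using free[of 1 0 \<beta> \<alpha> "(1 + \<beta>) / r" "\<alpha> / r"] assms red r_pos by auto
  moreover have "r / 2 + (\<beta> - s) = r * ((1 + \<beta>) / r)"
    using r_pos by (simp add: s_def field_simps)
  ultimately show False
    using free[of "r / 2" 0 "\<beta> - s" \<alpha> "(1 + \<beta>) / r" "\<alpha> / r"] assms blue r_pos n by simp
qed

text \<open>The sign of \<open>s\<close> is unknown; the absolute value keeps all intermediate
  points above \<open>1 / r\<close> even when the steps lead downwards.\<close>

lemma shift_up_iterate:
  assumes "\<alpha> > 0" "\<phi> \<beta> \<alpha>" "\<beta> \<ge> 1 / r + of_nat k * \<bar>s / r\<bar>"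
  shows "\<phi> (\<beta> + of_nat k * (s / r)) \<alpha>"
proof -
  define t where "t = s / r"
  have "\<phi> (\<beta> + of_nat k * t) \<alpha>" if "\<beta> \<ge> 1 / r + of_nat k * \<bar>t\<bar>"
    using that
  proof (induction k)
    case 0
    then show ?case using assms by simp
  next
    case (Suc k)
    have *: "of_nat (Suc k) * x = of_nat k * x + x" for x :: rat
      by (simp add: algebra_simps)
    have "of_nat k * t \<ge> - (of_nat k * \<bar>t\<bar>)"
      using mult_left_mono[of "- \<bar>t\<bar>" t "of_nat k"] by simp
    then have le: "\<beta> \<ge> 1 / r + of_nat k * \<bar>t\<bar>" "\<beta> + of_nat k * t \<ge> 1 / r"
      using Suc.prems unfolding * by linarith+
    from shift_up[OF assms(1) le(2) Suc.IH[OF le(1)]] show ?case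
      unfolding * t_def by (simp add: add.assoc)
  qed
  then show ?thesis using assms(3) by (simp only: t_def)
qed

lemma shift_down_iterate:
  assumes "\<alpha> > 0" "\<phi> \<beta> \<alpha>" "\<beta> \<ge> of_nat k * \<bar>s\<bar>"
  shows "\<phi> (\<beta> - of_nat k * s) \<alpha>"
  using assms(3)
proof (induction k)
  case 0
  then show ?case using assms by simp
next
  case (Suc k)
  have *: "of_nat (Suc k) * t = of_nat k * t + t" for t :: rat
    by (simp add: algebra_simps)
  have "of_nat k * s \<le> of_nat k * \<bar>s\<bar>"
    by (simp add: mult_left_mono)
  then have le: "\<beta> \<ge> of_nat k * \<bar>s\<bar>" "\<beta> - of_nat k * s \<ge> 0" "\<beta> - of_nat k * s \<ge> s"
    using Suc.prems unfolding * by linarith+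
  from shift_down[OF assms(1) le(2,3) Suc.IH[OF le(1)]] show ?case
    unfolding * by (simp add: diff_diff_eq)
qed

text \<open>Upward steps have length \<open>s / r\<close> and downward steps length \<open>s\<close>; as \<open>r\<close> is rational,
  suitable numbers of them add up to an upward step of length \<open>s\<close>.\<close>

lemma r_quotient: obtains p q :: nat where "p > 0" "q > 0" "r = of_nat p / of_nat q"
proof -
  obtain a b where ab: "quotient_of r = (a, b)"
    by fastforce
  then have "b > 0" "r = of_int a / of_int b"
    by (simp_all add: quotient_of_denom_pos quotient_of_div)
  moreover from this have "a > 0"
    using r_pos by (simp add: zero_less_divide_iff)
  ultimately show thesis
    using that[of "nat a" "nat b"] by simp
qed

lemma shift_eq: "\<exists>T. \<forall>\<beta>\<ge>T. \<forall>\<alpha>>0. \<phi> (\<beta> + s) \<alpha> = \<phi> \<beta> \<alpha>"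
proof -
  obtain p q :: nat where pq: "p > 0" "q > 0" "r = of_nat p / of_nat q"
    by (rule r_quotient)
  then obtain q' where q': "q = Suc q'"
    using gr0_implies_Suc by blast
  \<comment> \<open>Since \<open>p = r q\<close>, exactly \<open>p\<close> upward steps have total
    length \<open>q s\<close>; undoing \<open>q' = q - 1\<close> lengths \<open>s\<close> by
    downward steps leaves \<open>s\<close>.\<close>
  have steps: "of_nat p * (s / r) = s + of_nat q' * s"
  proof -
    have "of_nat p = r * of_nat q"
      using pq by simp
    then have "of_nat p * (s / r) = of_nat q * s"
      using r_pos by simp
    then show ?thesis by (simp add: q' algebra_simps)
  qed
  have "\<phi> (\<beta> + s) \<alpha> = \<phi> \<beta> \<alpha>"
    if b: "\<beta> \<ge> 1 / r + of_nat p * \<bar>s / r\<bar> + of_nat q * \<bar>s\<bar>" and a: "\<alpha> > 0" for \<beta> \<alpha>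
  proof
    have abs: "of_nat q * \<bar>s\<bar> = of_nat q' * \<bar>s\<bar> + \<bar>s\<bar>"
      by (simp add: q' algebra_simps)
    have nonneg: "of_nat p * \<bar>s / r\<bar> \<ge> 0" "of_nat q' * \<bar>s\<bar> \<ge> 0" "of_nat q' * s \<ge> - (of_nat q' * \<bar>s\<bar>)"
      "1 / r > 0"
      using mult_left_mono[of "- \<bar>s\<bar>" s "of_nat q'"] r_pos by simp_all
    show "\<phi> \<beta> \<alpha>" if "\<phi> (\<beta> + s) \<alpha>"
    proof -
      have "\<beta> + s \<ge> 0" "\<beta> + s \<ge> s"
        using b abs nonneg by linarith+
      from shift_down[OF a this that] show ?thesis by simp
    qed
    show "\<phi> (\<beta> + s) \<alpha>" if red': "\<phi> \<beta> \<alpha>"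
    proof -
      have "\<beta> \<ge> 1 / r + of_nat p * \<bar>s / r\<bar>"
        using b abs nonneg by linarith
      from shift_up_iterate[OF a red' this] have "\<phi> (\<beta> + (s + of_nat q' * s)) \<alpha>"
        by (simp only: steps)
      moreover have "\<beta> + (s + of_nat q' * s) \<ge> of_nat q' * \<bar>s\<bar>"
      proof -
        have "\<bar>s + of_nat q' * s\<bar> \<le> of_nat p * \<bar>s / r\<bar>"
          unfolding steps[symmetric] by (simp add: abs_mult)
        then show ?thesis
          using b abs nonneg by linarith
      qed
      ultimately have "\<phi> (\<beta> + (s + of_nat q' * s) - of_nat q' * s) \<alpha>"
        by (rule shift_down_iterate[OF a])
      then show ?thesis by (simp add: algebra_simps)
    qed
  qed
  then show ?thesis by blast
qed

section \<open>Colour swap, addition and the resulting inconsistency\<close>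

text \<open>One direction is \<open>red_partner\<close>. If \<open>v\<close> is blue, then
  \<open>r v - (r / 2) u\<close> is red because of the blue \<open>(r / 2) u\<close>, and it differs
  from \<open>r v - u\<close> by one period \<open>s u\<close>.\<close>

lemma flip: "\<exists>T. \<forall>\<beta>\<ge>T. \<forall>\<alpha>>0. \<phi> (r * \<beta> - 1) (r * \<alpha>) = (\<not> \<phi> \<beta> \<alpha>)"
proof -
  obtain T where T: "\<And>\<beta> \<alpha>. \<beta> \<ge> T \<Longrightarrow> \<alpha> > 0 \<Longrightarrow> \<phi> (\<beta> + s) \<alpha> = \<phi> \<beta> \<alpha>"
    using shift_eq by blast
  have "\<phi> (r * \<beta> - 1) (r * \<alpha>) = (\<not> \<phi> \<beta> \<alpha>)"
    if b: "\<beta> \<ge> max (1 / r) (max (1 / 2) ((T + 1 + \<bar>s\<bar>) / r))" and a: "\<alpha> > 0" for \<beta> \<alpha>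
  proof (cases "\<phi> \<beta> \<alpha>")
    case True
    then show ?thesis using red_partner[OF a _ True] b by simp
  next
    case False
    have "\<phi> (r * \<beta> - r / 2) (r * \<alpha>)"
    proof (rule ccontr)
      assume "\<not> \<phi> (r * \<beta> - r / 2) (r * \<alpha>)"
      moreover have "r * \<beta> - r / 2 \<ge> 0"
        using b r_pos by (simp add: field_simps)
      ultimately show False
        using free[of "r / 2" 0 "r * \<beta> - r / 2" "r * \<alpha>" \<beta> \<alpha>] False blue a r_pos by simp
    qed
    moreover have "r * \<beta> - r / 2 = (r * \<beta> - 1) - s"
      by (simp add: s_def field_simps)
    moreover have "r * \<beta> - 1 - s \<ge> T"
    proof -
      have "r * \<beta> \<ge> T + 1 + \<bar>s\<bar>"
        using b r_pos by (simp add: field_simps)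
      then show ?thesis by linarith
    qed
    ultimately show ?thesis
      using T[of "r * \<beta> - 1 - s" "r * \<alpha>"] a r_pos False by simp
  qed
  then show ?thesis by blast
qed

text \<open>The partners \<open>r v - u\<close> and \<open>r v' - u\<close> both have the colour
  opposite to \<open>v\<close> and \<open>v'\<close>, and they sum to
  \<open>r (v + v' - (2 / r) u)\<close>.\<close>

lemma mono_add:
  assumes "s \<noteq> 0"
  shows "\<exists>T. \<forall>\<beta>\<ge>T. \<forall>\<alpha>>0. \<forall>\<beta>'\<ge>T. \<forall>\<alpha>'>0. \<phi> \<beta> \<alpha> = \<phi> \<beta>' \<alpha>' \<longrightarrow>
    \<phi> (\<beta> + \<beta>' - 2 / r) (\<alpha> + \<alpha>') = \<phi> \<beta> \<alpha>"
proof -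
  obtain T where T: "\<And>\<beta> \<alpha>. \<beta> \<ge> T \<Longrightarrow> \<alpha> > 0 \<Longrightarrow> \<phi> (\<beta> + s) \<alpha> = \<phi> \<beta> \<alpha>"
    using shift_eq by blast
  obtain U where U: "\<And>\<beta> \<alpha>. \<beta> \<ge> U \<Longrightarrow> \<alpha> > 0 \<Longrightarrow> \<phi> (r * \<beta> - 1) (r * \<alpha>) = (\<not> \<phi> \<beta> \<alpha>)"
    using flip by blast
  have indep: "\<phi> (\<beta> + \<beta>' - 2 / r) (\<alpha> + \<alpha>') = \<phi> \<beta> \<alpha>"
    if b: "\<beta> \<ge> max U (1 / r)" "\<beta>' \<ge> max U (1 / r)" and a: "\<alpha> > 0" "\<alpha>' > 0"
      and eq: "\<phi> \<beta> \<alpha> = \<phi> \<beta>' \<alpha>'" and det: "(r * \<beta> - 1) * \<alpha>' \<noteq> (r * \<beta>' - 1) * \<alpha>"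
    for \<beta> \<beta>' \<alpha> \<alpha>'
  proof (rule ccontr)
    assume n: "\<phi> (\<beta> + \<beta>' - 2 / r) (\<alpha> + \<alpha>') \<noteq> \<phi> \<beta> \<alpha>"
    have "r * \<beta> - 1 \<ge> 0" "r * \<beta>' - 1 \<ge> 0"
      using b r_pos by (simp_all add: field_simps)
    moreover have "(r * \<beta> - 1) * (r * \<alpha>') \<noteq> (r * \<alpha>) * (r * \<beta>' - 1)"
      using det r_pos by (simp add: mult.left_commute mult.commute mult.assoc)
    moreover have "(r * \<beta> - 1) + (r * \<beta>' - 1) = r * (\<beta> + \<beta>' - 2 / r)"
      using r_pos by (simp add: field_simps)
    ultimately show False
      using free[of "r * \<beta> - 1" "r * \<alpha>" "r * \<beta>' - 1" "r * \<alpha>'" "\<beta> + \<beta>' - 2 / r" "\<alpha> + \<alpha>'"]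
        U[of \<beta> \<alpha>] U[of \<beta>' \<alpha>'] a b eq n r_pos by (simp add: distrib_left)
  qed
  have "\<phi> (\<beta> + \<beta>' - 2 / r) (\<alpha> + \<alpha>') = \<phi> \<beta> \<alpha>"
    if b: "\<beta> \<ge> max T (max U (1 / r)) + \<bar>s\<bar>" "\<beta>' \<ge> max T (max U (1 / r)) + \<bar>s\<bar>"
      and a: "\<alpha> > 0" "\<alpha>' > 0" and eq: "\<phi> \<beta> \<alpha> = \<phi> \<beta>' \<alpha>'"
    for \<beta> \<beta>' \<alpha> \<alpha>'
  proof (cases "(r * \<beta> - 1) * \<alpha>' = (r * \<beta>' - 1) * \<alpha>")
    case False
    have "\<beta> \<ge> max U (1 / r)" "\<beta>' \<ge> max U (1 / r)"
      using b by linarith+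
    from indep[OF this a eq False] show ?thesis .
  next
    case True
    have le: "\<beta> + s \<ge> max U (1 / r)" "\<beta>' - s \<ge> max U (1 / r)" "\<beta> \<ge> T" "\<beta>' - s \<ge> T"
      using b by linarith+
    \<comment> \<open>Dependent partners are made independent by moving \<open>v\<close> by
      \<open>s u\<close> and \<open>v'\<close> by \<open>- s u\<close>: colours and sum stay, but
      the determinant becomes nonzero.\<close>
    have "(r * (\<beta> + s) - 1) * \<alpha>' - (r * (\<beta>' - s) - 1) * \<alpha> = r * s * (\<alpha> + \<alpha>')"
      using True by (simp add: algebra_simps)
    moreover have "r * s * (\<alpha> + \<alpha>') \<noteq> 0"
      using a r_pos assms by simp
    ultimately have "(r * (\<beta> + s) - 1) * \<alpha>' \<noteq> (r * (\<beta>' - s) - 1) * \<alpha>"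
      by auto
    moreover have "\<phi> (\<beta> + s) \<alpha> = \<phi> \<beta> \<alpha>" "\<phi> (\<beta>' - s) \<alpha>' = \<phi> \<beta>' \<alpha>'"
      using T[OF le(3) a(1)] T[OF le(4) a(2)] by simp_all
    ultimately show ?thesis
      using indep[OF le(1,2) a] eq by (simp add: algebra_simps)
  qed
  then show ?thesis by blast
qed

text \<open>Repeated addition of the same vector by \<open>mono_add\<close>, each time at the cost
  of a shift by \<open>2 / r\<close>; \<open>\<beta> \<ge> 2 / r\<close> keeps the multiples above
  the threshold.\<close>

lemma multiples:
  assumes "s \<noteq> 0"
  shows "\<exists>T. \<forall>\<beta>\<ge>T. \<forall>\<alpha>>0. \<forall>k::nat.
    \<phi> (of_nat (Suc k) * \<beta> - of_nat k * (2 / r)) (of_nat (Suc k) * \<alpha>) = \<phi> \<beta> \<alpha>"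
proof -
  obtain T where T: "\<And>\<beta> \<alpha> \<beta>' \<alpha>'. \<beta> \<ge> T \<Longrightarrow> \<alpha> > 0 \<Longrightarrow> \<beta>' \<ge> T \<Longrightarrow> \<alpha>' > 0 \<Longrightarrow>
      \<phi> \<beta> \<alpha> = \<phi> \<beta>' \<alpha>' \<Longrightarrow> \<phi> (\<beta> + \<beta>' - 2 / r) (\<alpha> + \<alpha>') = \<phi> \<beta> \<alpha>"
    using mono_add[OF assms] by blast
  have "\<phi> (of_nat (Suc k) * \<beta> - of_nat k * (2 / r)) (of_nat (Suc k) * \<alpha>) = \<phi> \<beta> \<alpha>"
    if b: "\<beta> \<ge> max T (2 / r)" and a: "\<alpha> > 0" for \<beta> \<alpha> and k :: nat
  proof (induction k)
    case 0
    then show ?case by simp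
  next
    case (Suc k)
    have "of_nat k * \<beta> \<ge> of_nat k * (2 / r)"
      using b by (intro mult_left_mono) auto
    then have "of_nat (Suc k) * \<beta> - of_nat k * (2 / r) \<ge> T"
      using b by (simp add: algebra_simps)
    moreover have "of_nat (Suc k) * \<alpha> > 0"
      using a by simp
    ultimately have "\<phi> (\<beta> + (of_nat (Suc k) * \<beta> - of_nat k * (2 / r)) - 2 / r)
        (\<alpha> + of_nat (Suc k) * \<alpha>) = \<phi> \<beta> \<alpha>"
      using T[of \<beta> \<alpha> "of_nat (Suc k) * \<beta> - of_nat k * (2 / r)" "of_nat (Suc k) * \<alpha>"] Suc.IH b a
      by simp
    moreover have "\<beta> + (of_nat (Suc k) * \<beta> - of_nat k * (2 / r)) - 2 / r =
        of_nat (Suc (Suc k)) * \<beta> - of_nat (Suc k) * (2 / r)"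
      by (simp add: algebra_simps add_divide_distrib)
    moreover have "\<alpha> + of_nat (Suc k) * \<alpha> = of_nat (Suc (Suc k)) * \<alpha>"
      by (simp add: algebra_simps)
    ultimately show ?case by (simp only:)
  qed
  then show ?thesis by blast
qed

text \<open>With \<open>r = p / q\<close>, the \<open>p\<close>-fold multiple of \<open>x\<close> and the \<open>q\<close>-fold multiple of its
  oppositely coloured partner \<open>r x - u\<close> differ by exactly \<open>2 q\<close> upward steps.\<close>

lemma inconsistent:
  assumes "r \<noteq> 2"
  shows False
proof -
  have s0: "s \<noteq> 0"
    using assms by (simp add: s_def)
  obtain p q :: nat where pq: "p > 0" "q > 0" "r = of_nat p / of_nat q"
    by (rule r_quotient)
  obtain p' q' where suc: "p = Suc p'" "q = Suc q'"
    using pq gr0_implies_Suc by blast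
  obtain U where U: "\<And>\<beta> \<alpha>. \<beta> \<ge> U \<Longrightarrow> \<alpha> > 0 \<Longrightarrow> \<phi> (r * \<beta> - 1) (r * \<alpha>) = (\<not> \<phi> \<beta> \<alpha>)"
    using flip by blast
  obtain T where T: "\<And>\<beta> \<alpha> k. \<beta> \<ge> T \<Longrightarrow> \<alpha> > 0 \<Longrightarrow>
      \<phi> (of_nat (Suc k) * \<beta> - of_nat k * (2 / r)) (of_nat (Suc k) * \<alpha>) = \<phi> \<beta> \<alpha>"
    using multiples[OF s0] by blast
  \<comment> \<open>The term \<open>2 / r\<close> ensures \<open>X \<ge> \<beta>\<close> below; the
    rest leaves room for \<open>2 q\<close> upward steps from \<open>X\<close>.\<close>
  define V where "V = 1 / r + of_nat (2 * q) * \<bar>s / r\<bar> + 2 / r"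
  have V: "V \<ge> 2 / r" "V \<ge> 1 / r + of_nat (2 * q) * \<bar>s / r\<bar>"
  proof -
    have "1 / r > 0" "2 / r > 0" "of_nat (2 * q) * \<bar>s / r\<bar> \<ge> 0"
      using r_pos by simp_all
    then show "V \<ge> 2 / r" "V \<ge> 1 / r + of_nat (2 * q) * \<bar>s / r\<bar>"
      unfolding V_def by linarith+
  qed
  define W where "W = Max {T, U, V, (T + 1) / r}"
  have W: "W \<ge> T" "W \<ge> U" "W \<ge> V" "W \<ge> (T + 1) / r"
    by (simp_all add: W_def)
  \<comment> \<open>A red vector beyond \<open>W\<close> exists: either the test vector is red or
    its partner is, and the summand \<open>(\<bar>W\<bar> + 1) / r\<close> keeps the partner beyond
    \<open>W\<close>.\<close>
  obtain \<beta> \<alpha> where b: "\<beta> \<ge> W" and a: "\<alpha> > 0" and red': "\<phi> \<beta> \<alpha>"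
  proof (cases "\<phi> ((\<bar>W\<bar> + 1) / r + \<bar>W\<bar>) 1")
    case True
    have "(\<bar>W\<bar> + 1) / r \<ge> 0"
      using r_pos by simp
    then have "(\<bar>W\<bar> + 1) / r + \<bar>W\<bar> \<ge> W" by linarith
    then show thesis using True that by (meson zero_less_one)
  next
    case False
    have "(\<bar>W\<bar> + 1) / r \<ge> 0"
      using r_pos by simp
    then have "(\<bar>W\<bar> + 1) / r + \<bar>W\<bar> \<ge> U" using W by linarith
    then have "\<phi> (r * ((\<bar>W\<bar> + 1) / r + \<bar>W\<bar>) - 1) (r * 1)"
      using U[of "(\<bar>W\<bar> + 1) / r + \<bar>W\<bar>" 1] False by simp
    moreover have "r * ((\<bar>W\<bar> + 1) / r + \<bar>W\<bar>) - 1 = \<bar>W\<bar> + r * \<bar>W\<bar>"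
      using r_pos by (simp add: field_simps)
    moreover have "\<bar>W\<bar> + r * \<bar>W\<bar> \<ge> W"
      using r_pos by (simp add: add_increasing2)
    ultimately show thesis using that r_pos by simp
  qed
  define X where "X = of_nat p * \<beta> - of_nat p' * (2 / r)"
  have X: "\<phi> X (of_nat p * \<alpha>)"
    using T[of \<beta> \<alpha> p'] b W a red' by (simp add: X_def suc)
  have "of_nat p' * \<beta> \<ge> of_nat p' * (2 / r)"
    using b W V by (intro mult_left_mono) auto
  then have "X \<ge> \<beta>"
    by (simp add: X_def suc algebra_simps)
  then have "X \<ge> 1 / r + of_nat (2 * q) * \<bar>s / r\<bar>"
    using b W V by linarith
  from shift_up_iterate[OF _ X this]
  have 1: "\<phi> (X + of_nat (2 * q) * (s / r)) (of_nat p * \<alpha>)"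
    using a pq by simp
  have "r * \<beta> - 1 \<ge> T"
  proof -
    have "T + 1 \<le> r * W"
      using W(4) r_pos by (simp add: field_simps)
    also have "\<dots> \<le> r * \<beta>"
      using b r_pos by simp
    finally show ?thesis by simp
  qed
  then have "\<phi> (of_nat q * (r * \<beta> - 1) - of_nat q' * (2 / r)) (of_nat q * (r * \<alpha>)) = \<phi> (r * \<beta> - 1) (r * \<alpha>)"
    using T[of "r * \<beta> - 1" "r * \<alpha>" q'] a r_pos by (simp add: suc)
  then have 2: "\<not> \<phi> (of_nat q * (r * \<beta> - 1) - of_nat q' * (2 / r)) (of_nat q * (r * \<alpha>))"
    using U[of \<beta> \<alpha>] b W a red' by simp
  have of_nat_eqs: "of_nat q' = of_nat q - (1::rat)" "of_nat p' = of_nat p - (1::rat)" "of_nat p = r * of_nat q"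
    using pq by (simp_all add: suc)
  then have "of_nat q * (r * \<beta> - 1) - of_nat q' * (2 / r) = X + of_nat (2 * q) * (s / r)"
    unfolding X_def s_def of_nat_eqs using r_pos by (simp add: field_simps)
  moreover have "of_nat q * (r * \<alpha>) = of_nat p * \<alpha>"
    using pq by simp
  ultimately have "\<not> \<phi> (X + of_nat (2 * q) * (s / r)) (of_nat p * \<alpha>)"
    using 2 by (simp only: simp_thms)
  then show False using 1 by contradiction
qed

end

section \<open>Reduction of an arbitrary colouring to the split case\<close>

text \<open>The van der Waerden number for two colours and length three is 9; the instances in the
  proof are all sixteen progressions within 0 to 8.\<close>

lemma ap3:
  fixes A :: "nat \<Rightarrow> bool"
  shows "\<exists>i j k. i + k = 2 * j \<and> i \<noteq> k \<and> A i = A j \<and> A j = A k"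
proof (rule ccontr)
  assume "\<not> ?thesis"
  then have none: "\<not> (i + k = 2 * j \<and> i \<noteq> k \<and> A i = A j \<and> A j = A k)" for i j k
    by blast
  have *: "\<not> (A i = A (i + d) \<and> A (i + d) = A (i + 2 * d))" if "d > 0" for i d
  proof -
    have "i + (i + 2 * d) = 2 * (i + d)" "i \<noteq> i + 2 * d"
      using that by simp_all
    then show ?thesis using none by blast
  qed
  show False
    using *[of 1 0] *[of 1 1] *[of 1 2] *[of 1 3] *[of 1 4] *[of 1 5] *[of 1 6]
      *[of 2 0] *[of 2 1] *[of 2 2] *[of 2 3] *[of 2 4] *[of 3 0] *[of 3 1] *[of 3 2] *[of 4 0]
    by (simp add: numeral_eq_Suc) argo
qed

lemma (in solution_free) contradiction: False
proof (cases "\<exists>v1 v2. v1 \<ge> 0 \<and> v2 \<ge> 0 \<and> (v1, v2) \<noteq> (0, 0) \<and> \<phi> (r / 2 * v1) (r / 2 * v2) \<noteq> \<phi> v1 v2")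
  case False
  then have inv: "\<phi> (r / 2 * v1) (r / 2 * v2) = \<phi> v1 v2" if "v1 \<ge> 0" "v2 > 0" for v1 v2
  proof -
    have "(v1, v2) \<noteq> (0, 0)"
      using that by simp
    then show ?thesis using False that less_imp_le by blast
  qed
  \<comment> \<open>Distinct points with second coordinate 1 are linearly independent.\<close>
  obtain i j k :: nat where ijk: "i + k = 2 * j" "i \<noteq> k"
    "\<phi> (of_nat i) 1 = \<phi> (of_nat j) 1" "\<phi> (of_nat j) 1 = \<phi> (of_nat k) 1"
    using ap3[of "\<lambda>i. \<phi> (of_nat i) 1"] by blast
  have "\<phi> (of_nat j) 1 = \<phi> (2 / r * of_nat j) (2 / r)"
    using inv[of "2 / r * of_nat j" "2 / r"] r_pos by simp
  moreover have "of_nat i + of_nat k = 2 * (of_nat j :: rat)"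
    using ijk(1) by (metis of_nat_add of_nat_mult of_nat_numeral)
  ultimately show False
    using free[of "of_nat i" 1 "of_nat k" 1 "2 / r * of_nat j" "2 / r"] ijk r_pos by simp
next
  case True
  then obtain v1 v2 where v: "v1 \<ge> 0" "v2 \<ge> 0" "(v1, v2) \<noteq> (0, 0)"
    and split: "\<phi> (r / 2 * v1) (r / 2 * v2) \<noteq> \<phi> v1 v2"
    by blast
  have "r \<noteq> 2" using split by auto
  obtain e1 e2 :: rat where e: "e1 \<ge> 0" "e2 \<ge> 0" "v1 * e2 \<noteq> v2 * e1"
  proof (cases "v1 = 0")
    case True
    then show thesis using v that[of 1 0] by simp
  next
    case False
    then show thesis using v that[of 0 1] by simp
  qed
  \<comment> \<open>New coordinates in the basis \<open>v\<close>, \<open>e\<close>, with red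
    meaning the colour of \<open>v\<close>. Both basis vectors lie in the quadrant, so nonnegative
    coordinates stay there.\<close>
  define \<psi> where "\<psi> \<beta> \<alpha> \<longleftrightarrow> \<phi> (\<beta> * v1 + \<alpha> * e1) (\<beta> * v2 + \<alpha> * e2) = \<phi> v1 v2" for \<beta> \<alpha>
  interpret solution_free_split r \<psi>
  proof
    fix x1 x2 y1 y2 z1 z2 :: rat
    assume nonneg: "x1 \<ge> 0" "x2 \<ge> 0" "y1 \<ge> 0" "y2 \<ge> 0"
      and sol: "x1 + y1 = r * z1" "x2 + y2 = r * z2"
      and det: "x1 * y2 \<noteq> x2 * y1"
      and eq: "\<psi> x1 x2 = \<psi> y1 y2" "\<psi> y1 y2 = \<psi> z1 z2"
    have "(x1 * v1 + x2 * e1) * (y1 * v2 + y2 * e2) - (x1 * v2 + x2 * e2) * (y1 * v1 + y2 * e1)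
        = (x1 * y2 - x2 * y1) * (v1 * e2 - v2 * e1)"
      by (simp add: algebra_simps)
    then have det': "(x1 * v1 + x2 * e1) * (y1 * v2 + y2 * e2) \<noteq>
        (x1 * v2 + x2 * e2) * (y1 * v1 + y2 * e1)"
      using det e(3) by auto
    have sol': "(x1 * w + x2 * e) + (y1 * w + y2 * e) = r * (z1 * w + z2 * e)" for w e
    proof -
      have "(x1 * w + x2 * e) + (y1 * w + y2 * e) = (x1 + y1) * w + (x2 + y2) * e"
        by (simp add: algebra_simps)
      then show ?thesis by (simp add: sol algebra_simps)
    qed
    show False
      by (rule free[OF _ _ _ _ sol' sol' det'])
        (use nonneg v e eq in \<open>auto simp: \<psi>_def\<close>)
  qed (use r_pos split in \<open>auto simp: \<psi>_def\<close>)
  show False using inconsistent \<open>r \<noteq> 2\<close> by blast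
qed

section \<open>Finitely many triples with integer coefficients\<close>

text \<open>Compactness: the colourings avoiding all the given triples form an intersection of clopen
  sets in the Cantor space \<open>'a \<Rightarrow> bool\<close>.\<close>

lemma finite_unavoidable_triples:
  fixes S :: "('a \<times> 'a \<times> 'a) set"
  assumes "\<And>\<phi> :: 'a \<Rightarrow> bool. \<exists>(x, y, z)\<in>S. \<phi> x = \<phi> y \<and> \<phi> y = \<phi> z"
  obtains F where "finite F" "F \<subseteq> S"
    "\<And>\<phi> :: 'a \<Rightarrow> bool. \<exists>(x, y, z)\<in>F. \<phi> x = \<phi> y \<and> \<phi> y = \<phi> z"
proof -
  let ?X = "product_topology (\<lambda>_. discrete_topology UNIV) UNIV :: ('a \<Rightarrow> bool) topology"
  \<comment> \<open>Dual form of the compactness argument: the open sets \<open>mono t\<close> for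
    \<open>t\<close> in \<open>S\<close> cover the space, and a finite subcover gives
    \<open>F\<close>.\<close>
  define mono where "mono = (\<lambda>(x, y, z). {\<phi> :: 'a \<Rightarrow> bool. \<phi> x = \<phi> y \<and> \<phi> y = \<phi> z})"
  have "compact_space (discrete_topology (UNIV :: bool set))"
    by (simp add: compact_space_discrete_topology)
  then have cmp: "compact_space ?X"
    by (simp add: compact_space_product_topology)
  have top: "topspace ?X = UNIV"
    by simp
  have fibre: "openin ?X {\<phi>. \<phi> x = b}" for x b
  proof -
    have "continuous_map ?X (discrete_topology UNIV) (\<lambda>\<phi>. \<phi> x)"
      by (rule continuous_map_product_projection) simp
    then have "openin ?X {\<phi> \<in> topspace ?X. \<phi> x \<in> {b}}"
      by (rule openin_continuous_map_preimage) simp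
    then show ?thesis by (simp only: top) simp
  qed
  have opn: "openin ?X (mono t)" for t
  proof -
    obtain x y z where t: "t = (x, y, z)" by (cases t)
    have "mono t = (\<Union>b. {\<phi>. \<phi> x = b} \<inter> {\<phi>. \<phi> y = b} \<inter> {\<phi>. \<phi> z = b})"
      unfolding mono_def t by auto
    moreover have "openin ?X \<dots>"
      by (intro openin_Union openin_Int fibre ballI) (auto intro: openin_Int fibre)
    ultimately show ?thesis by simp
  qed
  have cover: "topspace ?X \<subseteq> \<Union>(mono ` S)"
  proof
    fix \<phi> :: "'a \<Rightarrow> bool"
    obtain x y z where "(x, y, z) \<in> S" "\<phi> x = \<phi> y \<and> \<phi> y = \<phi> z"
      using assms[of \<phi>] by blast
    then have "\<phi> \<in> mono (x, y, z)"
      by (simp add: mono_def)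
    then show "\<phi> \<in> \<Union>(mono ` S)"
      using \<open>(x, y, z) \<in> S\<close> by blast
  qed
  obtain \<F> where "finite \<F>" "\<F> \<subseteq> mono ` S" and sub: "topspace ?X \<subseteq> \<Union>\<F>"
    using cmp cover opn unfolding compact_space_alt by (metis (no_types, lifting) imageE)
  then obtain F where F: "finite F" "F \<subseteq> S" "\<F> = mono ` F"
    by (metis finite_subset_image)
  show thesis
  proof
    show "finite F" "F \<subseteq> S" by fact+
    fix \<phi> :: "'a \<Rightarrow> bool"
    have "\<phi> \<in> \<Union>\<F>" using sub unfolding top by blast
    then obtain t where "t \<in> F" "\<phi> \<in> mono t"
      using F(3) by blast
    then show "\<exists>(x, y, z)\<in>F. \<phi> x = \<phi> y \<and> \<phi> y = \<phi> z"
      by (cases t) (auto simp: mono_def)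
  qed
qed

lemma common_denominator:
  fixes A :: "rat set"
  assumes "finite A" "\<And>q. q \<in> A \<Longrightarrow> q \<ge> 0"
  shows "\<exists>M::nat. M > 0 \<and> (\<forall>q\<in>A. of_nat M * q \<in> \<nat>)"
  using assms
proof (induction A)
  case empty
  then show ?case by auto
next
  case (insert q A)
  then obtain M :: nat where M: "M > 0" "\<forall>q\<in>A. of_nat M * q \<in> \<nat>"
    by auto
  obtain a b where ab: "quotient_of q = (a, b)"
    by fastforce
  then have b: "b > 0" and q: "q = of_int a / of_int b"
    by (simp_all add: quotient_of_denom_pos quotient_of_div)
  have "a \<ge> 0"
    using insert.prems[of q] b q by (simp add: zero_le_divide_iff)
  have "of_nat (M * nat b) * q = of_nat (M * nat a)"
    using b \<open>a \<ge> 0\<close> by (simp add: q)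
  moreover have "of_nat (M * nat b) * p \<in> \<nat>" if "p \<in> A" for p
    using Nats_mult[of "of_nat (nat b)" "of_nat M * p"] M that by (simp add: mult_ac)
  ultimately show ?case
    using M b by (intro exI[of _ "M * nat b"]) (auto simp del: of_nat_mult)
qed

text \<open>A pair \<open>(x1, x2)\<close> stands for the linear form \<open>x1 i + x2 j\<close>;
  the equation holds identically in \<open>i\<close> and \<open>j\<close>.\<close>

definition forms :: "nat \<Rightarrow> nat \<Rightarrow> ((nat \<times> nat) \<times> (nat \<times> nat) \<times> (nat \<times> nat)) set" where
  "forms a c = {((x1, x2), (y1, y2), (z1, z2)).
     a * (x1 + y1) = c * z1 \<and> a * (x2 + y2) = c * z2 \<and> x1 * y2 \<noteq> x2 * y1}"

text \<open>The conditions are homogeneous, so a common denominator of the finitely many rational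
  triples can be cleared; colourings of integer pairs are pulled back along this scaling.\<close>

lemma finite_unavoidable_forms:
  assumes "a > 0" "c > 0"
  obtains G where "finite G" "G \<subseteq> forms a c"
    "\<And>\<phi> :: nat \<times> nat \<Rightarrow> bool. \<exists>(x, y, z)\<in>G. \<phi> x = \<phi> y \<and> \<phi> y = \<phi> z"
proof -
  define r :: rat where "r = of_nat c / of_nat a"
  have r: "r > 0" using assms by (simp add: r_def)
  define S :: "((rat \<times> rat) \<times> (rat \<times> rat) \<times> (rat \<times> rat)) set" where
    "S = {((x1, x2), (y1, y2), (z1, z2)). x1 \<ge> 0 \<and> x2 \<ge> 0 \<and> y1 \<ge> 0 \<and> y2 \<ge> 0 \<and>
       x1 + y1 = r * z1 \<and> x2 + y2 = r * z2 \<and> x1 * y2 \<noteq> x2 * y1}"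
  have "\<exists>(x, y, z)\<in>S. \<phi> x = \<phi> y \<and> \<phi> y = \<phi> z" for \<phi> :: "rat \<times> rat \<Rightarrow> bool"
  proof (rule ccontr)
    assume n: "\<not> ?thesis"
    interpret solution_free r "\<lambda>u v. \<phi> (u, v)"
    proof
      fix x1 x2 y1 y2 z1 z2 :: rat
      assume eq: "\<phi> (x1, x2) = \<phi> (y1, y2)" "\<phi> (y1, y2) = \<phi> (z1, z2)"
        and "x1 \<ge> 0" "x2 \<ge> 0" "y1 \<ge> 0" "y2 \<ge> 0" "x1 + y1 = r * z1" "x2 + y2 = r * z2"
          "x1 * y2 \<noteq> x2 * y1"
      then have "((x1, x2), (y1, y2), (z1, z2)) \<in> S"
        by (simp add: S_def)
      moreover have "case ((x1, x2), (y1, y2), (z1, z2)) of (x, y, z) \<Rightarrow> \<phi> x = \<phi> y \<and> \<phi> y = \<phi> z"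
        using eq by simp
      ultimately show False
        using n by (meson bexI)
    qed (rule r)
    show False by (rule contradiction)
  qed
  then obtain F where F: "finite F" "F \<subseteq> S"
    "\<And>\<phi> :: rat \<times> rat \<Rightarrow> bool. \<exists>(x, y, z)\<in>F. \<phi> x = \<phi> y \<and> \<phi> y = \<phi> z"
    by (rule finite_unavoidable_triples) blast
  define A where "A = (\<Union>((x1, x2), (y1, y2), (z1, z2))\<in>F. {x1, x2, y1, y2, z1, z2})"
  have "finite A"
    using F(1) by (auto simp: A_def)
  moreover have "q \<ge> 0" if "q \<in> A" for q
  proof -
    have "z \<ge> 0" if "x \<ge> 0" "y \<ge> 0" "x + y = r * z" for x y z
    proof -
      have "r * z \<ge> 0"
        using that by (metis add_nonneg_nonneg)
      then show ?thesis
        using r by (simp add: zero_le_mult_iff)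
    qed
    moreover obtain x1 x2 y1 y2 z1 z2 where f: "((x1, x2), (y1, y2), (z1, z2)) \<in> F"
      and q: "q \<in> {x1, x2, y1, y2, z1, z2}"
      using \<open>q \<in> A\<close> by (auto simp: A_def)
    moreover have "x1 \<ge> 0 \<and> x2 \<ge> 0 \<and> y1 \<ge> 0 \<and> y2 \<ge> 0 \<and> x1 + y1 = r * z1 \<and> x2 + y2 = r * z2"
      using f F(2) by (auto simp: S_def)
    ultimately show ?thesis
      by blast
  qed
  ultimately obtain M :: nat where M: "M > 0" "\<And>q. q \<in> A \<Longrightarrow> of_nat M * q \<in> \<nat>"
    using common_denominator[of A] by metis
  \<comment> \<open>Total, but equal to multiplication by \<open>M\<close> only on \<open>A\<close>,
    where the floor is exact.\<close>
  define k where "k q = nat \<lfloor>of_nat M * q\<rfloor>" for q :: rat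
  have k: "of_nat (k q) = of_nat M * q" if "q \<in> A" for q
    using M(2)[OF that] by (auto simp: k_def elim!: Nats_cases)
  define K where "K = map_prod k k"
  define G where "G = map_prod K (map_prod K K) ` F"
  show thesis
  proof
    show "finite G" using F(1) by (simp add: G_def)
    show "G \<subseteq> forms a c"
    proof
      fix t assume "t \<in> G"
      then obtain x1 x2 y1 y2 z1 z2 where f: "((x1, x2), (y1, y2), (z1, z2)) \<in> F"
        and t: "t = ((k x1, k x2), (k y1, k y2), (k z1, k z2))"
        by (auto simp: G_def K_def)
      have in_A: "{x1, x2, y1, y2, z1, z2} \<subseteq> A"
        unfolding A_def by (rule subset_trans[OF _ UN_upper[OF f]]) simp
      have scaled: "a * (k x + k y) = c * k z" if "x + y = r * z" "{x, y, z} \<subseteq> A" for x y z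
      proof -
        have "of_nat a * (x + y) = of_nat c * z"
          using that(1) assms by (simp add: r_def)
        then have "of_nat M * (of_nat a * (x + y)) = of_nat M * (of_nat c * z)"
          by (simp only:)
        moreover have "of_nat (a * (k x + k y)) = of_nat M * (of_nat a * (x + y))"
          "of_nat (c * k z) = of_nat M * (of_nat c * z)"
          using that(2) by (simp_all add: k algebra_simps)
        ultimately have "of_nat (a * (k x + k y)) = (of_nat (c * k z) :: rat)"
          by (simp only:)
        then show ?thesis by (simp only: of_nat_eq_iff)
      qed
      have "k x1 * k y2 \<noteq> k x2 * k y1"
      proof
        assume "k x1 * k y2 = k x2 * k y1"
        then have "of_nat (k x1) * of_nat (k y2) = (of_nat (k x2) * of_nat (k y1) :: rat)"
          by (metis of_nat_mult)
        then have "x1 * y2 = x2 * y1"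
          using in_A M(1) by (simp add: k)
        then show False
          using f F(2) by (auto simp: S_def)
      qed
      show "t \<in> forms a c"
      proof -
        have "x1 + y1 = r * z1" "x2 + y2 = r * z2"
          using f F(2) by (auto simp: S_def)
        then have "a * (k x1 + k y1) = c * k z1" "a * (k x2 + k y2) = c * k z2"
          using in_A by (auto intro: scaled)
        then show ?thesis
          using \<open>k x1 * k y2 \<noteq> k x2 * k y1\<close> by (simp add: t forms_def)
      qed
    qed
    show "\<exists>(x, y, z)\<in>G. \<phi> x = \<phi> y \<and> \<phi> y = \<phi> z" for \<phi> :: "nat \<times> nat \<Rightarrow> bool"
    proof -
      obtain x y z where "(x, y, z) \<in> F" "\<phi> (K x) = \<phi> (K y)" "\<phi> (K y) = \<phi> (K z)"
        using F(3)[of "\<lambda>v. \<phi> (K v)"] by blast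
      moreover from this have "(K x, K y, K z) \<in> G"
        unfolding G_def by (metis image_eqI map_prod_simp)
      ultimately show ?thesis by blast
    qed
  qed
qed

section \<open>Counting solutions through parameter pairs\<close>

text \<open>Cramer's rule over \<open>int\<close>: the nonzero determinant annihilates both
  coordinate differences.\<close>

lemma linear_forms_inj:
  fixes x1 x2 y1 y2 i j i' j' :: nat
  assumes "x1 * y2 \<noteq> x2 * y1"
    and "x1 * i + x2 * j = x1 * i' + x2 * j'" "y1 * i + y2 * j = y1 * i' + y2 * j'"
  shows "i = i' \<and> j = j'"
proof -
  let ?d = "int x1 * int y2 - int x2 * int y1"
  have d: "?d \<noteq> 0" using assms(1) by (metis eq_iff_diff_eq_0 of_nat_eq_iff of_nat_mult)
  have "int x1 * int i + int x2 * int j = int x1 * int i' + int x2 * int j'"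
    "int y1 * int i + int y2 * int j = int y1 * int i' + int y2 * int j'"
    using assms(2,3) by (metis of_nat_add of_nat_mult)+
  then have "?d * (int i - int i') = 0" "?d * (int j - int j') = 0"
    by algebra+
  then show ?thesis using d by simp
qed

definition eval_form :: "nat \<times> nat \<Rightarrow> nat \<times> nat \<Rightarrow> nat" where
  "eval_form v w = fst v * fst w + snd v * snd w"

text \<open>Every parameter pair in the grid yields a monochromatic solution through some
  \<open>t\<close> in \<open>G\<close>, and each \<open>t\<close> accounts for at most as many pairs
  as there are solutions, because evaluation is injective.\<close>

lemma grid_le_mono_solutions:
  assumes "a > 0" and "c > 0" and f: "f ` {1..n} \<subseteq> {-1, 1}"
    and G: "finite G" "G \<subseteq> forms a c"
    "\<And>\<phi> :: nat \<times> nat \<Rightarrow> bool. \<exists>(x, y, z)\<in>G. \<phi> x = \<phi> y \<and> \<phi> y = \<phi> z"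
    and L: "\<And>x y z v. (x, y, z) \<in> G \<Longrightarrow> v \<in> {x, y, z} \<Longrightarrow> fst v + snd v \<le> L"
    and m: "L * m \<le> n"
  shows "m * m \<le> card G * card (mono_solutions a c n f)"
proof -
  let ?S = "mono_solutions a c n f"
  define ev where "ev w = (\<lambda>(x, y, z). (eval_form x w, eval_form y w, eval_form z w))" for w
  define B where "B t = {w. ev w t \<in> ?S}" for t
  have fin: "finite ?S"
    by (rule finite_subset[of _ "{1..n} \<times> {1..n} \<times> {1..n}"]) (auto simp: mono_solutions_def)
  have B: "finite (B t) \<and> card (B t) \<le> card ?S" if "t \<in> G" for t
  proof -
    obtain x1 x2 y1 y2 z where t: "t = ((x1, x2), (y1, y2), z)"
      by (cases t) auto
    then have det: "x1 * y2 \<noteq> x2 * y1"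
      using that G(2) by (auto simp: forms_def)
    have inj: "inj_on (\<lambda>w. ev w t) (B t)"
    proof (rule inj_onI)
      fix w w' assume "ev w t = ev w' t"
      then have "x1 * fst w + x2 * snd w = x1 * fst w' + x2 * snd w'"
        "y1 * fst w + y2 * snd w = y1 * fst w' + y2 * snd w'"
        by (simp_all add: ev_def t eval_form_def)
      from linear_forms_inj[OF det this] show "w = w'"
        by (simp add: prod_eq_iff)
    qed
    have sub: "(\<lambda>w. ev w t) ` B t \<subseteq> ?S"
      by (auto simp: B_def)
    show ?thesis
      using inj sub fin by (meson card_inj_on_le inj_on_finite)
  qed
  have "{1..m} \<times> {1..m} \<subseteq> (\<Union>t\<in>G. B t)"
  proof
    fix w assume w: "w \<in> {1..m} \<times> {1..m}"
    \<comment> \<open>For fixed \<open>w\<close>, evaluation turns \<open>f\<close> into a colouring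
      of coefficient pairs.\<close>
    obtain x y z where t: "(x, y, z) \<in> G"
      and eq: "(f (eval_form x w) = 1) = (f (eval_form y w) = 1)"
        "(f (eval_form y w) = 1) = (f (eval_form z w) = 1)"
      using G(3)[of "\<lambda>v. f (eval_form v w) = 1"] by blast
    obtain x1 x2 y1 y2 z1 z2 where xyz: "x = (x1, x2)" "y = (y1, y2)" "z = (z1, z2)"
      by (cases x, cases y, cases z)
    have sol: "a * (x1 + y1) = c * z1" "a * (x2 + y2) = c * z2" "x1 * y2 \<noteq> x2 * y1"
      using t G(2) by (auto simp: forms_def xyz)
    have range: "eval_form v w \<in> {1..n}" if "v \<in> {x, y, z}" for v
    proof -
      \<comment> \<open>The determinant excludes zero for \<open>x\<close> and \<open>y\<close>; a
        zero \<open>z\<close> would force both to vanish. As parameters start at 1, the value is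
        then positive.\<close>
      have "v \<noteq> (0, 0)"
        using that sol assms(1,2) by (auto simp: xyz)
      then have "eval_form v w \<ge> 1"
        using w by (cases v) (auto simp: eval_form_def Suc_le_eq)
      moreover have "eval_form v w \<le> fst v * m + snd v * m"
        using w unfolding eval_form_def by (intro add_mono mult_left_mono) auto
      moreover have "fst v * m + snd v * m \<le> L * m"
        using L[OF t that] by (metis add_mult_distrib mult_le_mono1)
      ultimately show ?thesis using m by simp
    qed
    have "f (eval_form v w) = - 1 \<or> f (eval_form v w) = 1" if "v \<in> {x, y, z}" for v
      using f range[OF that] by blast
    from this[of x] this[of y] this[of z]
    have "f (eval_form x w) = f (eval_form y w)" "f (eval_form y w) = f (eval_form z w)"
      using eq by auto
    moreover have "a * eval_form x w + a * eval_form y w = c * eval_form z w"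
    proof -
      have "a * eval_form x w + a * eval_form y w = a * (x1 + y1) * fst w + a * (x2 + y2) * snd w"
        by (simp add: eval_form_def xyz algebra_simps)
      then show ?thesis
        unfolding sol by (simp add: eval_form_def xyz algebra_simps)
    qed
    then have "int a * int (eval_form x w) + int a * int (eval_form y w)
        - int c * int (eval_form z w) = 0"
      by (metis eq_iff_diff_eq_0 of_nat_add of_nat_mult)
    ultimately have "w \<in> B (x, y, z)"
      using range by (simp add: B_def ev_def mono_solutions_def)
    then show "w \<in> (\<Union>t\<in>G. B t)" using t by blast
  qed
  moreover have "finite (\<Union>t\<in>G. B t)"
    using B G(1) by blast
  ultimately have "card ({1..m} \<times> {1..m}) \<le> card (\<Union>t\<in>G. B t)"
    by (intro card_mono)
  then have "m * m \<le> card (\<Union>t\<in>G. B t)"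
    by (simp add: card_cartesian_product)
  also have "\<dots> \<le> (\<Sum>t\<in>G. card (B t))"
    by (rule card_UN_le[OF G(1)])
  also have "\<dots> \<le> (\<Sum>t\<in>G. card ?S)"
    using B by (intro sum_mono) blast
  finally show ?thesis by simp
qed

theorem theorem3p2:
  fixes a c :: nat
  assumes "a > 0" and "c > 0"
  shows "\<exists>\<kappa>::real. \<kappa> > 0 \<and> (\<exists>N::nat. \<forall>n\<ge>N. \<forall>f :: nat \<Rightarrow> int.
           coloring n f \<longrightarrow> real (card (mono_solutions a c n f)) \<ge> \<kappa> * (real n)\<^sup>2)"
proof -
  obtain G where G: "finite G" "G \<subseteq> forms a c"
    "\<And>\<phi> :: nat \<times> nat \<Rightarrow> bool. \<exists>(x, y, z)\<in>G. \<phi> x = \<phi> y \<and> \<phi> y = \<phi> z"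
    by (rule finite_unavoidable_forms[OF assms]) (rule that)
  have "G \<noteq> {}" using G(3) by blast
  then have g: "card G > 0" using G(1) by (simp add: card_gt_0_iff)
  define V where "V = (\<Union>(x, y, z)\<in>G. {x, y, z})"
  have "finite V" using G(1) by (auto simp: V_def)
  \<comment> \<open>A crude bound on all coefficient sums; \<open>Suc\<close> makes it positive for
    the division by \<open>L\<close>.\<close>
  define L where "L = Suc (\<Sum>v\<in>V. fst v + snd v)"
  have L: "fst v + snd v \<le> L" if "(x, y, z) \<in> G" "v \<in> {x, y, z}" for x y z v
  proof -
    have "v \<in> V" unfolding V_def using that by blast
    then show ?thesis
      using member_le_sum[of v V "\<lambda>v. fst v + snd v"] \<open>finite V\<close> by (simp add: L_def)
  qed
  have L_pos: "L > 0" by (simp add: L_def)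
  \<comment> \<open>From \<open>n \<le> 2 L m\<close> with \<open>m = n div L\<close>, squared and
    combined with the bound on \<open>m * m\<close>.\<close>
  define \<kappa> where "\<kappa> = 1 / (4 * real L ^ 2 * real (card G))"
  have "real (card (mono_solutions a c n f)) \<ge> \<kappa> * (real n)\<^sup>2"
    if "n \<ge> L" "coloring n f" for n f
  proof -
    define m where "m = n div L"
    have "m \<ge> 1" using that L_pos by (simp add: m_def Suc_le_eq div_greater_zero_iff)
    have "n < L * m + L"
      using L_pos by (metis m_def mult_div_mod_eq add_less_cancel_left mod_less_divisor)
    also have "\<dots> \<le> 2 * L * m" using \<open>m \<ge> 1\<close> by simp
    finally have "real n \<le> 2 * real L * real m"
      by (metis less_imp_le of_nat_le_iff of_nat_mult of_nat_numeral)
    then have "(real n)\<^sup>2 \<le> (2 * real L * real m)\<^sup>2"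
      by (intro power_mono) auto
    also have "\<dots> = 4 * real L ^ 2 * real (m * m)"
      by (simp add: power2_eq_square)
    also have "\<dots> \<le> 4 * real L ^ 2 * real (card G * card (mono_solutions a c n f))"
    proof (intro mult_left_mono of_nat_mono)
      show "m * m \<le> card G * card (mono_solutions a c n f)"
      proof (rule grid_le_mono_solutions[OF assms _ G])
        show "f ` {1..n} \<subseteq> {-1, 1}"
          using that by (simp add: coloring_def)
        show "L * m \<le> n"
          by (simp add: m_def)
      qed (rule L)
    qed simp
    finally show ?thesis
      using g L_pos by (simp add: \<kappa>_def field_simps)
  qed
  moreover have "\<kappa> > 0" using g L_pos by (simp add: \<kappa>_def)
  ultimately show ?thesis by blast
qed

end
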